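(* Let $G$ be a finite graph whose characteristic polynomial is irreducible over $\mathbf{Q}$. Then all vertices of $G$ are dominant.
   Context: A finite graph $G=(V,E)$ has a finite nonempty vertex set $V$ and a set $E$ of unordered pairs of distinct vertices. The adjacency operator $A$ is the self-adjoint operator on $\ell^2(V)=\mathbf{C}^V$ given by $(A\xi)(v)=\sum_{w:\{v,w\}\in E}\xi(w)$; $\delta_v$ is the characteristic function of $\{v\}$. The characteristic polynomial of $G$ is the characteristic polynomial of $A$; since the matrix of $A$ in the basis $(\delta_v)_{v\in V}$ has entries in $\{0,1\}$, it lies in $\mathbf{Q}[T]$. The local spectral measure $\mu_\xi$ of $A$ at $\xi\in\ell^2(V)$ is the positive measure on the spectrum $\Sigma(A)$ with $\int f\,d\mu_\xi=\langle f(A)\xi\mid\xi\rangle$ for all functions $f:\Sigma(A)\to\mathbf{C}$. A vertex $v$ is dominant if for every $\eta\in\ell^2(V)$ the measure $\mu_\eta$ is absolutely continuous with respect to $\mu_{\delta_v}$. *)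

theory Defs
  imports "HOL-Analysis.Analysis" "HOL-Computational_Algebra.Computational_Algebra"
begin

text \<open>
  The vertex set of a graph is a nonempty finite type \<open>'v\<close>; the graph is given by its set of edges,
  each an unordered pair of distinct vertices. The space \<open>\<ell>\<^sup>2(V)\<close> is \<open>complex ^ 'v\<close>, and
  the characteristic function of \<open>{v}\<close> is \<open>axis v 1\<close>.
\<close>

definition simple_graph :: "'v::finite set set \<Rightarrow> bool" where
  "simple_graph E \<longleftrightarrow> (\<forall>e\<in>E. card e = 2)"

definition adjacency_op :: "'v::finite set set \<Rightarrow> complex ^ 'v \<Rightarrow> complex ^ 'v" where
  "adjacency_op E \<xi> = (\<chi> v. \<Sum>w | {v, w} \<in> E. \<xi> $ w)"

definition char_polynomial :: "(complex ^ 'v::finite \<Rightarrow> complex ^ 'v) \<Rightarrow> complex poly" where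
  "char_polynomial A = det (mat [:0, 1:] - map_matrix (\<lambda>a. [:a:]) (matrix A))"

definition graph_char_polynomial :: "'v::finite set set \<Rightarrow> complex poly" where
  "graph_char_polynomial E = char_polynomial (adjacency_op E)"

definition irreducible_over_rat :: "complex poly \<Rightarrow> bool" where
  "irreducible_over_rat P \<longleftrightarrow> (\<exists>p :: rat poly. P = map_poly of_rat p \<and> irreducible p)"

text \<open>
  The library's inner product on \<open>complex ^ 'v\<close> is real-valued, so the Hermitian one, linear in the
  first argument, is introduced here.
\<close>

definition hermitian_inner :: "complex ^ 'v::finite \<Rightarrow> complex ^ 'v \<Rightarrow> complex" where
  "hermitian_inner x y = (\<Sum>v\<in>UNIV. x $ v * cnj (y $ v))"

definition orthogonal_projection ::
    "(complex ^ 'v::finite) set \<Rightarrow> complex ^ 'v \<Rightarrow> complex ^ 'v" where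
  "orthogonal_projection W x = (THE p. p \<in> W \<and> (\<forall>w\<in>W. hermitian_inner (x - p) w = 0))"

definition spectrum :: "(complex ^ 'v::finite \<Rightarrow> complex ^ 'v) \<Rightarrow> complex set" where
  "spectrum A = {z. \<not> bij (\<lambda>x. A x - z *s x)}"

definition eigenspace ::
    "(complex ^ 'v::finite \<Rightarrow> complex ^ 'v) \<Rightarrow> complex \<Rightarrow> (complex ^ 'v) set" where
  "eigenspace A z = {x. A x = z *s x}"

text \<open>
  Functional calculus \<open>f(A)\<close> of a self-adjoint operator \<open>A\<close>, obtained from its spectral
  decomposition. Only the values of \<open>f\<close> on the spectrum of \<open>A\<close> matter.
\<close>

definition functional_calculus ::
    "(complex \<Rightarrow> complex) \<Rightarrow> (complex ^ 'v::finite \<Rightarrow> complex ^ 'v) \<Rightarrow> complex ^ 'v \<Rightarrow> complex ^ 'v"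
  where
  "functional_calculus f A x =
     (\<Sum>z\<in>spectrum A. f z *s orthogonal_projection (eigenspace A z) x)"

text \<open>
  The spectrum is a finite set, with all its subsets measurable. Requiring every \<open>f\<close> to be
  integrable forces the measure to be finite, which makes it unique.
\<close>

definition local_spectral_measure ::
    "(complex ^ 'v::finite \<Rightarrow> complex ^ 'v) \<Rightarrow> complex ^ 'v \<Rightarrow> complex measure" where
  "local_spectral_measure A \<xi> =
     (THE M. space M = spectrum A \<and> sets M = Pow (spectrum A) \<and>
       (\<forall>f. has_bochner_integral M f (hermitian_inner (functional_calculus f A \<xi>) \<xi>)))"

text \<open>In the library, \<open>absolutely_continuous M N\<close> says that \<open>N\<close> is absolutely continuous
  with respect to \<open>M\<close>.\<close>

definition dominant :: "'v::finite set set \<Rightarrow> 'v \<Rightarrow> bool" where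
  "dominant E v \<longleftrightarrow>
     (\<forall>\<eta>. absolutely_continuous (local_spectral_measure (adjacency_op E) (axis v 1))
                              (local_spectral_measure (adjacency_op E) \<eta>))"

end

theory Submission imports Defs "HOL-Computational_Algebra.Field_as_Ring" begin

text \<open>
  Fix an eigenvalue \<open>z\<close> and a vertex \<open>v\<close>, and suppose that every eigenvector for \<open>z\<close> vanishes at
  \<open>v\<close>. Such an eigenvector, restricted to the other vertices, is also an eigenvector of the graph
  with \<open>v\<close> removed, so \<open>z\<close> is a root of the characteristic polynomial of that smaller graph. This is
  a nonzero rational polynomial of degree less than that of the minimal polynomial of \<open>z\<close>, a
  contradiction. Hence \<open>\<delta>\<^sub>v\<close> has a nonzero component in every eigenspace, so that its spectral
  measure charges every point of the spectrum.
\<close>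

section \<open>Rational polynomials\<close>

lemma map_poly_of_rat_add:
  "map_poly of_rat (p + q) = (map_poly of_rat p + map_poly of_rat q :: 'a::field_char_0 poly)"
  by (rule poly_eqI) (simp add: coeff_map_poly of_rat_add)

lemma map_poly_of_rat_mult:
  "map_poly of_rat (p * q) = (map_poly of_rat p * map_poly of_rat q :: 'a::field_char_0 poly)"
  by (rule poly_eqI) (simp add: coeff_map_poly coeff_mult of_rat_sum of_rat_mult)

text \<open>If \<open>p\<close> did not divide \<open>q\<close>, the two would be coprime, and a
  Bezout identity over the rationals, evaluated at \<open>z\<close>, would read 0 = 1. This plays
  the role of the minimal polynomial of \<open>z\<close>.\<close>

lemma irreducible_dvd_of_common_root:
  fixes z :: "'a::field_char_0"
  assumes "irreducible p" "poly (map_poly of_rat p) z = 0" "poly (map_poly of_rat q) z = 0"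
  shows "p dvd q"
proof (rule ccontr)
  assume "\<not> p dvd q"
  then have "coprime p q"
    using assms(1) by (intro prime_elem_imp_coprime irreducible_imp_prime_elem)
  then obtain a b where "a * p + b * q = 1"
    by (metis bezout_coefficients_fst_snd coprime_iff_gcd_eq_1)
  then have "poly (map_poly of_rat (a * p + b * q)) z = 1"
    by (simp add: map_poly_1)
  then show False
    using assms by (simp add: map_poly_of_rat_add map_poly_of_rat_mult)
qed

lemma coeff_mult_Rats:
  assumes "\<And>i. coeff p i \<in> \<rat>" "\<And>i. coeff q i \<in> \<rat>"
  shows "coeff (p * q) i \<in> \<rat>"
  using assms by (auto simp: coeff_mult intro!: Rats_sum Rats_mult)

lemma coeff_prod_Rats:
  assumes "\<And>x i. x \<in> S \<Longrightarrow> coeff (f x) i \<in> \<rat>"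
  shows "coeff (\<Prod>x\<in>S. f x) i \<in> \<rat>"
  using assms
proof (induction S arbitrary: i rule: infinite_finite_induct)
  case (insert x S)
  then show ?case by (auto intro!: coeff_mult_Rats)
qed auto

lemma coeff_det_Rats:
  fixes M :: "'a::field_char_0 poly ^ 'n::finite ^ 'n"
  assumes "\<And>i j k. coeff (M $ i $ j) k \<in> \<rat>"
  shows "coeff (det M) k \<in> \<rat>"
proof -
  have "coeff (of_int (sign p) :: 'a poly) k \<in> \<rat>" for p :: "'n \<Rightarrow> 'n" and k
    by (simp add: sign_def)
  then show ?thesis
    unfolding det_def coeff_sum
    by (intro Rats_sum coeff_mult_Rats coeff_prod_Rats assms)
qed

section \<open>Characteristic polynomials\<close>

lemma poly_det:
  fixes M :: "'a::comm_ring_1 poly ^ 'n::finite ^ 'n"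
  shows "poly (det M) z = det (\<chi> i j. poly (M $ i $ j) z)"
proof -
  have "poly (of_int (sign p)) z = of_int (sign p)" for p :: "'n \<Rightarrow> 'n"
    by (simp add: sign_def)
  then show ?thesis
    by (simp add: det_def poly_sum poly_prod)
qed

abbreviation char_matrix :: "'a::comm_ring_1 ^ 'n ^ 'n \<Rightarrow> 'a poly ^ 'n ^ 'n" where
  "char_matrix M \<equiv> mat [:0, 1:] - map_matrix (\<lambda>a. [:a:]) M"

text \<open>In the Leibniz expansion the identity permutation contributes a product of monic linear
  factors. Any other permutation meets a constant off-diagonal entry, so its term has smaller degree
  and cannot cancel the leading one.\<close>

lemma degree_det_char_matrix:
  fixes M :: "'a::field_char_0 ^ 'n::finite ^ 'n"
  shows "degree (det (char_matrix M)) = CARD('n)"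
proof -
  let ?C = "char_matrix M"
  let ?term = "\<lambda>p. of_int (sign p) * (\<Prod>i\<in>UNIV. ?C $ i $ p i)"
  let ?S = "{p. p permutes (UNIV :: 'n set)}"
  have fin: "finite ?S" by (simp add: finite_permutations)
  have diag: "?C $ i $ i = [:- (M $ i $ i), 1:]" for i
    by (simp add: mat_def)
  have offdiag: "i \<noteq> j \<Longrightarrow> ?C $ i $ j = [:- (M $ i $ j):]" for i j
    by (simp add: mat_def)
  have id: "degree (?term id) = CARD('n)"
    by (simp add: diag degree_prod_sum_eq del: vector_minus_component)
  have rest: "degree (?term p) < CARD('n)" if p: "p \<in> ?S - {id}" for p
  proof -
    obtain k where k: "p k \<noteq> k"
      using p by (auto simp: fun_eq_iff)
    have "degree (?term p) \<le> degree (\<Prod>i\<in>UNIV. ?C $ i $ p i)"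
      by (simp add: sign_def)
    also have "\<dots> \<le> (\<Sum>i\<in>UNIV. degree (?C $ i $ p i))"
      using degree_prod_sum_le[of UNIV "\<lambda>i. ?C $ i $ p i"] by (simp add: o_def)
    also have "\<dots> < (\<Sum>i\<in>(UNIV :: 'n set). 1)"
    proof (rule sum_strict_mono_ex1)
      show "\<forall>i\<in>UNIV. degree (?C $ i $ p i) \<le> 1"
      proof
        fix i show "degree (?C $ i $ p i) \<le> 1"
          by (cases "p i = i") (simp_all add: diag offdiag del: vector_minus_component)
      qed
      have "degree (?C $ k $ p k) = 0"
        using offdiag[of k "p k"] k by simp
      then show "\<exists>i\<in>UNIV. degree (?C $ i $ p i) < 1"
        by (metis UNIV_I zero_less_one)
    qed simp
    finally show ?thesis by simp
  qed
  have "det ?C = ?term id + (\<Sum>p\<in>?S - {id}. ?term p)"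
    unfolding det_def using fin by (subst sum.remove[of _ id]) (auto simp: permutes_id)
  also have "degree \<dots> = degree (?term id)"
    by (rule degree_add_eq_left, subst id, rule degree_sum_less)
       (use rest in \<open>auto simp: id\<close>)
  finally show ?thesis using id by simp
qed

text \<open>Row and column \<open>v\<close> become those of the identity matrix. The determinant is
  that of \<open>M\<close> with \<open>v\<close> deleted, while the index type stays the
  same.\<close>

definition principal_minor :: "'n \<Rightarrow> 'a::comm_ring_1 ^ 'n::finite ^ 'n \<Rightarrow> 'a" where
  "principal_minor v M =
     det (\<chi> i. if i = v then axis v 1 else (\<chi> j. if j = v then 0 else M $ i $ j))"

text \<open>Clearing row and column \<open>v\<close> of \<open>M\<close> multiplies the characteristic polynomial of the minor by \<open>T\<close>.\<close>

lemma
  fixes M :: "'a::field_char_0 ^ 'n::finite ^ 'n"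
  shows principal_minor_char_matrix_nonzero: "principal_minor v (char_matrix M) \<noteq> 0"
    and degree_principal_minor_char_matrix:
      "Suc (degree (principal_minor v (char_matrix M))) = CARD('n)"
proof -
  define M' where "M' = (\<chi> i j. if i = v \<or> j = v then 0 else M $ i $ j)"
  have "char_matrix M' =
      (\<chi> i. if i = v then [:0, 1:] *s axis v 1
            else (\<chi> j. if j = v then 0 else char_matrix M $ i $ j))"
    by (auto simp: vec_eq_iff M'_def mat_def axis_def)
  then have eq: "det (char_matrix M') = [:0, 1:] * principal_minor v (char_matrix M)"
    unfolding principal_minor_def by (simp only: det_row_mul)
  \<comment> \<open>A zero minor would make \<open>det (char_matrix M')\<close> zero, of degree 0,
    but its degree \<open>CARD('n)\<close> is positive.\<close>
  show nz: "principal_minor v (char_matrix M) \<noteq> 0"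
    using degree_det_char_matrix[of M'] eq by auto
  have "degree (det (char_matrix M')) = 1 + degree (principal_minor v (char_matrix M))"
    unfolding eq using nz by (subst degree_mult_eq) auto
  then show "Suc (degree (principal_minor v (char_matrix M))) = CARD('n)"
    by (simp add: degree_det_char_matrix)
qed

lemma coeff_principal_minor_Rats:
  fixes M :: "'a::field_char_0 poly ^ 'n::finite ^ 'n"
  assumes "\<And>i j k. coeff (M $ i $ j) k \<in> \<rat>"
  shows "coeff (principal_minor v M) k \<in> \<rat>"
  unfolding principal_minor_def
  by (rule coeff_det_Rats) (auto simp: assms axis_def coeff_1)

lemma poly_principal_minor:
  "poly (principal_minor v M) z = principal_minor v (\<chi> i j. poly (M $ i $ j) z)"
  unfolding principal_minor_def poly_det
  by (rule arg_cong[of _ _ det]) (auto simp: vec_eq_iff axis_def)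

lemma det_eq_0_iff_kernel:
  fixes M :: "'a::field ^ 'n::finite ^ 'n"
  shows "det M = 0 \<longleftrightarrow> (\<exists>x. x \<noteq> 0 \<and> M *v x = 0)"
  using invertible_det_nz[of M] invertible_left_inverse[of M] matrix_left_invertible_ker[of M]
  by auto

text \<open>As \<open>x\<close> vanishes at \<open>v\<close>, clearing column \<open>v\<close> does
  not affect the product with \<open>x\<close>, and the new row \<open>v\<close> returns
  \<open>x $ v\<close>. So \<open>x\<close> stays in the kernel.\<close>

lemma principal_minor_eq_0:
  fixes M :: "'a::field ^ 'n::finite ^ 'n" and x :: "'a ^ 'n"
  assumes "x \<noteq> 0" "M *v x = 0" "x $ v = 0"
  shows "principal_minor v M = 0"
proof -
  have "(\<Sum>j\<in>UNIV. (if j = v then 0 else M $ i $ j) * x $ j) = (M *v x) $ i" for i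
    unfolding matrix_vector_mult_def using assms(3) by (auto intro!: sum.cong)
  then have "(\<chi> i. if i = v then axis v 1 else (\<chi> j. if j = v then 0 else M $ i $ j)) *v x = 0"
    using assms(2,3)
    by (auto simp: vec_eq_iff matrix_vector_mult_def axis_def intro!: sum.neutral)
  then show ?thesis
    unfolding principal_minor_def det_eq_0_iff_kernel using assms(1) by blast
qed

section \<open>Eigenspaces and spectrum through the characteristic polynomial\<close>

lemma poly_char_matrix:
  "(\<chi> i j. poly (char_matrix M $ i $ j) z) = mat z - M"
  by (simp add: vec_eq_iff mat_def)

lemma mat_mult_vec: "mat z *v x = z *s (x :: 'a::comm_ring_1 ^ 'n::finite)"
  by (simp add: vec_eq_iff matrix_vector_mult_def mat_def if_distrib[of "\<lambda>a. a * _"]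
      cong: if_cong)

lemma kernel_eq_eigenspace:
  "(mat z - M) *v x = 0 \<longleftrightarrow> x \<in> eigenspace ((*v) M) z"
  by (auto simp: eigenspace_def matrix_vector_mult_diff_rdistrib mat_mult_vec)

lemma spectrum_iff_root:
  "z \<in> spectrum ((*v) M) \<longleftrightarrow> poly (char_polynomial ((*v) M)) z = 0"
proof -
  have "(\<lambda>x. M *v x - z *s x) = (*v) (M - mat z)"
    by (simp add: fun_eq_iff matrix_vector_mult_diff_rdistrib mat_mult_vec)
  then have "z \<in> spectrum ((*v) M) \<longleftrightarrow> det (M - mat z) = 0"
    by (simp add: spectrum_def invertible_det_nz flip: invertible_eq_bij)
  \<comment> \<open>The two determinants may differ by a sign, so they are compared through their
    common kernel.\<close>
  also have "\<dots> \<longleftrightarrow> det (mat z - M) = 0"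
    by (simp add: det_eq_0_iff_kernel matrix_vector_mult_diff_rdistrib) (metis eq_commute)
  also have "\<dots> \<longleftrightarrow> poly (char_polynomial ((*v) M)) z = 0"
    by (simp only: char_polynomial_def matrix_of_matrix_vector_mul poly_det poly_char_matrix)
  finally show ?thesis .
qed

lemma finite_spectrum: "finite (spectrum ((*v) M))"
proof -
  have "char_polynomial ((*v) M) \<noteq> 0"
    using degree_det_char_matrix[of M] by (auto simp: char_polynomial_def)
  moreover have "spectrum ((*v) M) = {z. poly (char_polynomial ((*v) M)) z = 0}"
    by (auto simp: spectrum_iff_root)
  ultimately show ?thesis
    by (simp add: poly_roots_finite)
qed

lemma eigenvector_nonzero_at:
  fixes M :: "complex ^ 'v::finite ^ 'v"
  assumes rat: "\<And>i j. M $ i $ j \<in> \<rat>"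
    and irred: "irreducible_over_rat (char_polynomial ((*v) M))"
    and z: "z \<in> spectrum ((*v) M)"
  obtains w :: "complex ^ 'v" where "w \<in> eigenspace ((*v) M) z" "w $ v \<noteq> 0"
proof (rule ccontr)
  assume "\<not> thesis"
  then have vanish: "\<And>w. w \<in> eigenspace ((*v) M) z \<Longrightarrow> w $ v = 0"
    using that by blast
  let ?P = "char_polynomial ((*v) M)" and ?Q = "principal_minor v (char_matrix M)"
  obtain p where p: "?P = map_poly of_rat p" "irreducible p"
    using irred by (auto simp: irreducible_over_rat_def)
  have "coeff ?Q k \<in> \<rat>" for k
    by (rule coeff_principal_minor_Rats)
       (auto simp: mat_def coeff_pCons rat split: nat.split intro!: Rats_diff)
  then obtain q where q: "?Q = map_poly of_rat q"
    using ratpolyE by blast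
  have "poly ?P z = 0"
    using z by (simp add: spectrum_iff_root)
  then have "det (mat z - M) = 0"
    by (simp only: char_polynomial_def matrix_of_matrix_vector_mul poly_det poly_char_matrix)
  \<comment> \<open>A nonzero eigenvector is essential: \<open>vanish\<close> alone would also hold
    for a zero eigenspace.\<close>
  then obtain x where "x \<noteq> 0" "(mat z - M) *v x = 0"
    by (auto simp: det_eq_0_iff_kernel)
  then have "poly ?Q z = 0"
    unfolding poly_principal_minor poly_char_matrix
    by (metis principal_minor_eq_0 vanish kernel_eq_eigenspace)
  with \<open>poly ?P z = 0\<close> have "p dvd q"
    using irreducible_dvd_of_common_root p q by metis
  \<comment> \<open>The embedding \<open>of_rat\<close> preserves degrees, so \<open>p\<close> has
    degree one more than the nonzero \<open>q\<close> it divides.\<close>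
  have "degree ?P = degree p" "degree ?Q = degree q"
    unfolding p q by (simp_all add: degree_map_poly)
  then have "Suc (degree q) = degree p"
    using degree_principal_minor_char_matrix[of v M] degree_det_char_matrix[of M]
    by (simp add: char_polynomial_def)
  moreover have "q \<noteq> 0"
    using principal_minor_char_matrix_nonzero[of v M] q by auto
  ultimately show False
    using dvd_imp_degree_le[OF \<open>p dvd q\<close>] by simp
qed

section \<open>Local spectral measures\<close>

lemma hermitian_inner_self: "hermitian_inner x x = of_real ((norm x)\<^sup>2)"
  by (simp add: hermitian_inner_def norm_vec_def L2_set_def sum_nonneg flip: complex_norm_square)

lemma inner_eq_Re_hermitian_inner: "x \<bullet> y = Re (hermitian_inner x y)"
  by (simp add: hermitian_inner_def inner_vec_def inner_complex_def)

lemma hermitian_inner_diff_left: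
  "hermitian_inner (x - y) w = hermitian_inner x w - hermitian_inner y w"
  by (simp add: hermitian_inner_def algebra_simps sum_subtractf)

lemma hermitian_inner_scale_right: "hermitian_inner x (c *s w) = cnj c * hermitian_inner x w"
  by (simp add: hermitian_inner_def algebra_simps sum_distrib_left)

lemma hermitian_inner_scale_left: "hermitian_inner (c *s x) w = c * hermitian_inner x w"
  by (simp add: hermitian_inner_def algebra_simps sum_distrib_left)

lemma hermitian_inner_sum_left: "hermitian_inner (sum f S) w = (\<Sum>z\<in>S. hermitian_inner (f z) w)"
  by (simp add: hermitian_inner_def sum_distrib_right sum.swap[of _ S])

lemma hermitian_inner_axis_left:
  fixes w :: "complex ^ 'v::finite"
  shows "hermitian_inner (axis v 1) w = cnj (w $ v)"
  by (simp add: hermitian_inner_def axis_def if_distrib[of "\<lambda>a. a * _"] cong: if_cong)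

text \<open>Existence comes from the orthogonal decomposition for the real inner product, since a
  complex subspace is also a real one; uniqueness comes from definiteness.\<close>

lemma orthogonal_projection_vec_subspace:
  fixes W :: "(complex ^ 'v::finite) set"
  assumes W: "vec.subspace W"
  shows "orthogonal_projection W x \<in> W"
    and "w \<in> W \<Longrightarrow> hermitian_inner (x - orthogonal_projection W x) w = 0"
proof -
  have "subspace W"
    unfolding subspace_def
  proof (intro conjI ballI allI)
    fix c :: real and w assume "w \<in> W"
    then have "complex_of_real c *s w \<in> W" using W by (rule vec.subspace_scale[rotated])
    moreover have "complex_of_real c *s w = c *\<^sub>R w"
      unfolding vec_eq_iff vector_smult_component vector_scaleR_component
      by (simp add: scaleR_conv_of_real)
    ultimately show "c *\<^sub>R w \<in> W" by simp
  qed (use W in \<open>auto simp: vec.subspace_def\<close>)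
  then have span: "span W = W"
    by (simp add: span_eq_iff)
  obtain p y where py: "p \<in> W" "\<And>w. w \<in> W \<Longrightarrow> y \<bullet> w = 0" "x = p + y"
    using orthogonal_subspace_decomp_exists[of W x] unfolding span orthogonal_def by metis
  have orth: "hermitian_inner (x - p) w = 0" if w: "w \<in> W" for w
  proof (rule complex_eqI)
    \<comment> \<open>Real orthogonality to \<open>w\<close> controls only the real part; testing
      against \<open>\<i> *s w\<close> yields the imaginary part.\<close>
    have "\<i> *s w \<in> W" using W w by (auto simp: vec.subspace_def)
    then have "Re (hermitian_inner y (\<i> *s w)) = 0"
      using py(2) by (metis inner_eq_Re_hermitian_inner)
    then show "Im (hermitian_inner (x - p) w) = Im 0"
      using py(3) by (simp add: hermitian_inner_scale_right)
    show "Re (hermitian_inner (x - p) w) = Re 0"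
      using py w by (simp flip: inner_eq_Re_hermitian_inner)
  qed
  have uniq: "q = p" if q: "q \<in> W" "\<forall>w\<in>W. hermitian_inner (x - q) w = 0" for q
  proof -
    have "q - p \<in> W" using W q(1) py(1) by (rule vec.subspace_diff)
    then have "hermitian_inner ((x - p) - (x - q)) (q - p) = 0"
      using q(2) orth by (simp add: hermitian_inner_diff_left)
    then show ?thesis by (simp add: hermitian_inner_self)
  qed
  have "orthogonal_projection W x = p"
    unfolding orthogonal_projection_def
    by (rule the_equality) (use py(1) orth uniq in blast)+
  then show "orthogonal_projection W x \<in> W"
    and "w \<in> W \<Longrightarrow> hermitian_inner (x - orthogonal_projection W x) w = 0"
    using py(1) orth by simp_all
qed

lemma hermitian_inner_orthogonal_projection:
  assumes "vec.subspace W"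
  shows "hermitian_inner (orthogonal_projection W x) x
    = of_real ((norm (orthogonal_projection W x))\<^sup>2)"
proof -
  let ?p = "orthogonal_projection W x"
  have "hermitian_inner x ?p = hermitian_inner ?p ?p"
    using orthogonal_projection_vec_subspace[OF assms]
    by (metis eq_iff_diff_eq_0 hermitian_inner_diff_left)
  moreover have "hermitian_inner ?p x = cnj (hermitian_inner x ?p)"
    by (simp add: hermitian_inner_def mult.commute)
  ultimately show ?thesis by (simp add: hermitian_inner_self)
qed

section \<open>Spectral measures as point measures\<close>

lemma subspace_eigenspace: "vec.subspace (eigenspace ((*v) M) z)"
  unfolding eigenspace_def
  by (rule vec.subspaceI)
     (auto simp: matrix_vector_right_distrib vec.scale_right_distrib vec.scale_left_commute
        matrix_vector_mult_scaleR vector_scalar_commute)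

text \<open>This is the uniqueness behind \<open>local_spectral_measure\<close>: integrating the
  indicator of a point determines its mass.\<close>

lemma eq_point_measure_if_has_bochner_integral:
  fixes g :: "'a \<Rightarrow> real"
  assumes "finite A" "space M = A" "sets M = Pow A" "\<And>a. a \<in> A \<Longrightarrow> 0 \<le> g a"
    and int: "\<And>f :: 'a \<Rightarrow> complex. has_bochner_integral M f (\<Sum>a\<in>A. f a * g a)"
  shows "M = point_measure A g"
proof (rule measure_eqI_finite[of _ A])
  fix a assume a: "a \<in> A"
  have "has_bochner_integral M (\<lambda>x. Re (indicator {a} x)) 
      (Re (\<Sum>b\<in>A. indicator {a} b * complex_of_real (g b)))"
    using int by (rule has_bochner_integral_Re)
  moreover have "(\<lambda>x. Re (indicator {a} x)) = (indicator {a} :: 'a \<Rightarrow> real)"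
    by (auto simp: indicator_def)
  moreover have "Re (\<Sum>b\<in>A. indicator {a} b * complex_of_real (g b)) = g a"
    using a assms(1) by (simp add: indicator_def if_distrib cong: if_cong)
  ultimately have *: "has_bochner_integral M (indicator {a} :: 'a \<Rightarrow> real) (g a)"
    by simp
  \<comment> \<open>Finiteness must be recorded too, because \<open>measure\<close> sends an
    infinite mass to 0.\<close>
  then have "emeasure M ({a} \<inter> space M) < \<infinity>" "measure M ({a} \<inter> space M) = g a"
    by (auto simp: has_bochner_integral_iff integrable_indicator_iff)
  then show "emeasure M {a} = emeasure (point_measure A g) {a}"
    using a assms(1,2)
    by (subst emeasure_eq_ennreal_measure) (auto simp: emeasure_point_measure_finite)
qed (use assms in \<open>auto simp: sets_point_measure\<close>)

lemma local_spectral_measure_eq_point_measure: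
  fixes M :: "complex ^ 'v::finite ^ 'v"
  shows "local_spectral_measure ((*v) M) \<xi> = point_measure (spectrum ((*v) M))
    (\<lambda>z. (norm (orthogonal_projection (eigenspace ((*v) M) z) \<xi>))\<^sup>2)"
    (is "_ = point_measure ?S _")
proof -
  let ?g = "\<lambda>z. (norm (orthogonal_projection (eigenspace ((*v) M) z) \<xi>))\<^sup>2"
  have fc: "hermitian_inner (functional_calculus f ((*v) M) \<xi>) \<xi> = (\<Sum>z\<in>?S. f z * of_real (?g z))"
    for f
    by (simp add: functional_calculus_def hermitian_inner_sum_left hermitian_inner_scale_left
        hermitian_inner_orthogonal_projection[OF subspace_eigenspace])
  have "has_bochner_integral (point_measure ?S ?g) f (\<Sum>z\<in>?S. f z * of_real (?g z))"
    for f :: "complex \<Rightarrow> complex"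
    unfolding has_bochner_integral_iff
    by (simp add: finite_spectrum integrable_point_measure_finite
        lebesgue_integral_point_measure_finite scaleR_conv_of_real mult.commute)
  then show ?thesis
    unfolding local_spectral_measure_def fc
    by (intro the_equality)
       (auto simp: space_point_measure sets_point_measure finite_spectrum
         intro!: eq_point_measure_if_has_bochner_integral)
qed

theorem proposition4p6:
  fixes E :: "'v::finite set set"
  assumes "simple_graph E"
    and "irreducible_over_rat (graph_char_polynomial E)"
  shows "\<forall>v. dominant E v"
proof
  fix v
  define M :: "complex ^ 'v ^ 'v" where "M = (\<chi> i j. if {i, j} \<in> E then 1 else 0)"
  have A: "adjacency_op E = (*v) M"
    by (simp add: fun_eq_iff vec_eq_iff adjacency_op_def M_def matrix_vector_mult_def
        if_distrib[of "\<lambda>a. a * _"] sum.If_cases cong: if_cong)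
  \<comment> \<open>A zero projection would make the characteristic function of \<open>v\<close>
    orthogonal to the eigenspace, yet its product with \<open>w\<close> is the conjugate of
    \<open>w $ v\<close>.\<close>
  have pos: "orthogonal_projection (eigenspace ((*v) M) z) (axis v 1) \<noteq> 0"
    if z: "z \<in> spectrum ((*v) M)" for z
  proof
    assume 0: "orthogonal_projection (eigenspace ((*v) M) z) (axis v 1) = 0"
    obtain w :: "complex ^ 'v" where w: "w \<in> eigenspace ((*v) M) z" "w $ v \<noteq> 0"
      by (rule eigenvector_nonzero_at[of M z v])
         (use assms(2) z in \<open>auto simp: M_def graph_char_polynomial_def A\<close>)
    have "hermitian_inner (axis v 1) w = 0"
      using orthogonal_projection_vec_subspace(2)[OF subspace_eigenspace w(1), of "axis v 1"]
      by (simp add: 0)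
    with w(2) show False
      by (simp add: hermitian_inner_axis_left)
  qed
  \<comment> \<open>By \<open>pos\<close> every point of the spectrum has positive mass at
    \<open>axis v 1\<close>, so no nonempty set is null and absolute continuity is
    immediate.\<close>
  show "dominant E v"
    unfolding dominant_def A local_spectral_measure_eq_point_measure
    by (auto intro!: absolutely_continuousI_point_measure_finite dest: pos)
qed

end
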